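(* Let $X$ be a real random variable that is symmetric with respect to zero (i.e. $X$ and $-X$ have the same distribution), with finite second moment and standard deviation $\sigma_X>0$, and let $\kappa>1$ be a fixed number. Then there exists a real random variable $X^*$ having compact support (with $\sigma_{X^*}>0$) such that $$p(\kappa;X)\leq p(\kappa;X^* ).$$
   Context: For a real random variable $Y$ with finite second moment and $\sigma_Y>0$, and for $\kappa>0$, the probability to have outliers on the level $\kappa$ is $$p(\kappa;Y)=\mathbb{P}\left\{\frac{|Y-\mathbb{E}Y|}{\sigma_Y}>\kappa\right\},$$ where $\mathbb{E}Y$ is the expectation of $Y$ and $\sigma_Y=\sqrt{\mathbb{E}(Y-\mathbb{E}Y)^2}$ is its standard deviation. A random variable $Y$ has compact support if its distribution has compact support, i.e. there is a finite $M$ with $\mathbb{P}\{|Y|\leq M\}=1$. *)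

theory Defs
  imports "HOL-Probability.Probability"
begin

definition finite_second_moment :: "'a measure \<Rightarrow> ('a \<Rightarrow> real) \<Rightarrow> bool" where
  "finite_second_moment M X \<longleftrightarrow>
     integrable M (\<lambda>\<omega>. (X \<omega>)\<^sup>2)"

definition std_dev :: "'a measure \<Rightarrow> ('a \<Rightarrow> real) \<Rightarrow> real" where
  "std_dev M X = sqrt (prob_space.variance M X)"

text \<open>Meaningful only for a random variable on a probability space with finite second
  moment and positive standard deviation.\<close>

definition outlier_prob :: "real \<Rightarrow> 'a measure \<Rightarrow> ('a \<Rightarrow> real) \<Rightarrow> real" where
  "outlier_prob \<kappa> M X =
     measure M {\<omega> \<in> space M.
       \<bar>X \<omega> - prob_space.expectation M X\<bar> / std_dev M X > \<kappa>}"

definition symmetric_about_zero :: "'a measure \<Rightarrow> ('a \<Rightarrow> real) \<Rightarrow> bool" where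
  "symmetric_about_zero M X \<longleftrightarrow> distr M borel X = distr M borel (\<lambda>\<omega>. - X \<omega>)"

definition compact_support :: "'a measure \<Rightarrow> ('a \<Rightarrow> real) \<Rightarrow> bool" where
  "compact_support M X \<longleftrightarrow> (\<exists>B::real. measure M {\<omega> \<in> space M. \<bar>X \<omega>\<bar> \<le> B} = 1)"

end

theory Submission
  imports Defs
begin

text \<open>The random variable X* may even be taken to have three values: it suffices that a symmetric
  distribution on {-1, 0, 1} with mass r off zero has standard deviation \<open>sqrt r\<close>, so that 1 and -1
  are outliers on the level \<kappa> whenever \<open>r < 1 / \<kappa>\<^sup>2\<close>. A positive outlier probability always satisfies
  this strict bound, because Chebyshev's inequality at a strict threshold is strict.\<close>

text \<open>If the bound failed, the gap between the two sides of Chebyshev's pointwise inequality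
  would be a nonnegative function with integral at most 0, hence zero almost everywhere. But it is
  strictly positive on the outlier event, which would then be null, against
  \<open>pos\<close>.\<close>

lemma strict_Chebyshev:
  fixes X :: "'a \<Rightarrow> real"
  assumes "prob_space M" and X: "X \<in> borel_measurable M"
    and m2: "finite_second_moment M X"
    and sd: "std_dev M X > 0" and \<kappa>: "\<kappa> > 0"
    and pos: "outlier_prob \<kappa> M X > 0"
  shows "outlier_prob \<kappa> M X * \<kappa>\<^sup>2 < 1"
proof (rule ccontr)
  interpret prob_space M by fact
  assume "\<not> outlier_prob \<kappa> M X * \<kappa>\<^sup>2 < 1"
  then have ge: "outlier_prob \<kappa> M X * \<kappa>\<^sup>2 \<ge> 1" by simp
  define s where "s = std_dev M X"
  define \<mu> where "\<mu> = expectation X"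
  define A where "A = {\<omega> \<in> space M. \<bar>X \<omega> - \<mu>\<bar> / s > \<kappa>}"
  \<comment> \<open>The Chebyshev gap: a square off \<open>A\<close>, and positive on
    \<open>A\<close> by the strict threshold.\<close>
  define f where "f = (\<lambda>\<omega>. (X \<omega> - \<mu>)\<^sup>2 - \<kappa>\<^sup>2 * s\<^sup>2 * indicator A \<omega>)"
  have q: "outlier_prob \<kappa> M X = prob A"
    by (simp add: outlier_prob_def A_def \<mu>_def s_def)
  have A [measurable]: "A \<in> sets M"
    using X unfolding A_def by measurable
  have s: "s > 0" using sd by (simp add: s_def)
  have var: "variance X = s\<^sup>2"
    unfolding s_def std_dev_def by (simp add: Bochner_Integration.integral_nonneg)
  have X2: "integrable M (\<lambda>\<omega>. (X \<omega>)\<^sup>2)"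
    using m2 by (simp add: finite_second_moment_def)
  have X1: "integrable M X"
    using square_integrable_imp_integrable[OF X X2] .
  have int1: "integrable M (\<lambda>\<omega>. (X \<omega> - \<mu>)\<^sup>2)"
    unfolding power2_diff using X1 X2 by simp
  have intA: "integrable M (\<lambda>\<omega>. \<kappa>\<^sup>2 * s\<^sup>2 * indicator A \<omega> :: real)"
    by (intro integrable_mult_right) (simp add: emeasure_eq_measure)
  have intf: "integrable M f"
    unfolding f_def using int1 intA by (rule Bochner_Integration.integrable_diff)
  have big: "(X \<omega> - \<mu>)\<^sup>2 > \<kappa>\<^sup>2 * s\<^sup>2" if "\<omega> \<in> A" for \<omega>
  proof -
    have "\<kappa> * s < \<bar>X \<omega> - \<mu>\<bar>"
      using that s by (simp add: A_def pos_less_divide_eq)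
    then have "(\<kappa> * s)\<^sup>2 < \<bar>X \<omega> - \<mu>\<bar>\<^sup>2"
      using s \<kappa> by (intro power_strict_mono) auto
    then show ?thesis by (simp add: power_mult_distrib)
  qed
  have nonneg: "f \<omega> \<ge> 0" for \<omega>
    using big[of \<omega>] by (cases "\<omega> \<in> A") (auto simp: f_def)
  have "(\<integral>\<omega>. f \<omega> \<partial>M) = s\<^sup>2 - \<kappa>\<^sup>2 * s\<^sup>2 * prob A"
    unfolding f_def using int1 intA var by (simp add: \<mu>_def)
  also have "\<dots> = s\<^sup>2 * (1 - prob A * \<kappa>\<^sup>2)"
    by (simp add: algebra_simps)
  also have "\<dots> \<le> 0"
    using ge q by (intro mult_nonneg_nonpos) auto
  finally have "(\<integral>\<omega>. f \<omega> \<partial>M) = 0"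
    by (rule antisym) (intro Bochner_Integration.integral_nonneg nonneg)
  then have "AE \<omega> in M. f \<omega> = 0"
    using integral_nonneg_eq_0_iff_AE[OF intf] nonneg by simp
  \<comment> \<open>By \<open>big\<close>, \<open>f\<close> has no zero on \<open>A\<close>.\<close>
  then have "AE \<omega> in M. \<omega> \<notin> A"
    by eventually_elim (use big in \<open>force simp: f_def\<close>)
  then have "prob A = 0"
    using prob_eq_0[OF A] by simp
  with pos q show False by simp
qed

text \<open>Building it as a mixture, a coin choosing between a fair sign and 0, makes it a
  \<open>pmf\<close> with no normalisation to prove. Outside the unit interval
  \<open>bernoulli_pmf\<close> clamps \<open>r\<close>, hence the bounds on \<open>r\<close> in the
  lemmas below.\<close>

definition three_point_pmf :: "real \<Rightarrow> real pmf" where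
  "three_point_pmf r =
     bind_pmf (bernoulli_pmf r) (\<lambda>b. if b then pmf_of_set {-1, 1} else return_pmf 0)"

lemma set_three_point_pmf: "set_pmf (three_point_pmf r) \<subseteq> {-1, 0, 1}"
  by (auto simp: three_point_pmf_def split: if_splits)

text \<open>The mass at 0 is left out: it enters the first two moments with factor 0, and the lower
  bound on the outlier probability counts only -1 and 1.\<close>

lemma pmf_three_point_pmf:
  assumes "0 \<le> r" "r \<le> 1"
  shows "pmf (three_point_pmf r) (-1) = r / 2" "pmf (three_point_pmf r) 1 = r / 2"
  using assms by (simp_all add: three_point_pmf_def pmf_bind)

lemma three_point_pmf_moments:
  assumes "0 \<le> r" "r \<le> 1"
  shows "measure_pmf.expectation (three_point_pmf r) (\<lambda>x. x) = 0"
    and "std_dev (measure_pmf (three_point_pmf r)) (\<lambda>x. x) = sqrt r"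
proof -
  have int: "measure_pmf.expectation (three_point_pmf r) f =
      (\<Sum>a\<in>{-1, 0, 1}. f a * pmf (three_point_pmf r) a)" for f :: "real \<Rightarrow> real"
    using set_three_point_pmf by (intro integral_measure_pmf_real) auto
  show mean: "measure_pmf.expectation (three_point_pmf r) (\<lambda>x. x) = 0"
    using assms by (simp add: int pmf_three_point_pmf)
  show "std_dev (measure_pmf (three_point_pmf r)) (\<lambda>x. x) = sqrt r"
    unfolding std_dev_def mean using assms by (simp add: int pmf_three_point_pmf)
qed

lemma three_point_pmf_outlier_prob:
  assumes r: "0 < r" "r \<le> 1" and \<kappa>: "\<kappa> \<ge> 0" "r * \<kappa>\<^sup>2 < 1"
  shows "outlier_prob \<kappa> (measure_pmf (three_point_pmf r)) (\<lambda>x. x) \<ge> r"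
proof -
  have "(sqrt r * \<kappa>)\<^sup>2 < 1\<^sup>2"
    using r \<kappa> by (simp add: power_mult_distrib)
  then have "sqrt r * \<kappa> < 1"
    by (rule power2_less_imp_less) simp
  \<comment> \<open>Since the mean is 0, \<open>1 / sqrt r\<close> is the standardised deviation of
    both -1 and 1.\<close>
  then have out: "\<kappa> < 1 / sqrt r"
    using r by (simp add: pos_less_divide_eq mult.commute)
  have "r = measure (three_point_pmf r) {-1, 1}"
    using r by (simp add: measure_measure_pmf_finite pmf_three_point_pmf)
  also have "\<dots> \<le> outlier_prob \<kappa> (measure_pmf (three_point_pmf r)) (\<lambda>x. x)"
    unfolding outlier_prob_def using r out
    by (intro measure_pmf.finite_measure_mono) (auto simp: three_point_pmf_moments)
  finally show ?thesis .
qed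

theorem theorem2p2:
  fixes M :: "'a measure" and X :: "'a \<Rightarrow> real" and \<kappa> :: real
  assumes "prob_space M"
    and "X \<in> borel_measurable M"
    and "symmetric_about_zero M X"
    and "finite_second_moment M X"
    and "std_dev M X > 0"
    and "\<kappa> > 1"
  shows "\<exists>(N :: real measure) (Y :: real \<Rightarrow> real).
           prob_space N \<and> Y \<in> borel_measurable N \<and>
           compact_support N Y \<and> finite_second_moment N Y \<and> std_dev N Y > 0 \<and>
           outlier_prob \<kappa> M X \<le> outlier_prob \<kappa> N Y"
proof -
  interpret prob_space M by fact
  define q where "q = outlier_prob \<kappa> M X"
  \<comment> \<open>Taking \<open>r = q\<close> would give a point mass at 0 with zero deviation
    when \<open>q = 0\<close>. In that case the inequality is trivial, so any positive mass will do;
    1 gives a fair sign.\<close>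
  define r where "r = (if q = 0 then 1 else q)"
  have q: "0 \<le> q" "q \<le> 1"
    by (simp_all add: q_def outlier_prob_def)
  then have r: "0 < r" "r \<le> 1" by (auto simp: r_def)
  let ?N = "measure_pmf (three_point_pmf r)" and ?Y = "\<lambda>x :: real. x"
  have "q \<le> outlier_prob \<kappa> ?N ?Y"
  proof (cases "q = 0")
    case True
    then show ?thesis by (simp add: outlier_prob_def)
  next
    case False
    with q have "q * \<kappa>\<^sup>2 < 1"
      unfolding q_def using assms by (intro strict_Chebyshev) auto
    then show ?thesis
      using three_point_pmf_outlier_prob[of r \<kappa>] r assms(6) False by (simp add: r_def)
  qed
  moreover have "compact_support ?N ?Y"
    unfolding compact_support_def
  proof
    have "AE x in ?N. \<bar>x\<bar> \<le> 1"
      using set_three_point_pmf[of r] by (force simp: AE_measure_pmf_iff)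
    then show "measure ?N {x \<in> space ?N. \<bar>x\<bar> \<le> 1} = 1"
      by (simp add: measure_pmf.prob_eq_1)
  qed
  moreover have "finite_second_moment ?N ?Y"
    unfolding finite_second_moment_def
    using finite_subset[OF set_three_point_pmf] by (intro integrable_measure_pmf_finite) auto
  moreover have "std_dev ?N ?Y > 0"
    using r by (simp add: three_point_pmf_moments)
  ultimately show ?thesis
    using measure_pmf.prob_space_axioms[of "three_point_pmf r"]
    by (intro exI[of _ ?N] exI[of _ ?Y]) (simp add: q_def)
qed

end
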